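(* Let $n,d\in\mathbb{N}$ with $d\in\{1,\ldots,n\}$ and let $(X,\|\cdot\|_X)$ be a complex Banach space. For every $p>q>1$ (with $p,q$ finite) and every function $f:\{-1,1\}^n\to X$ of degree at most $d$, we have $$\|f\|_{L_p(\{-1,1\}^n;X)}\leq T_d\Big(\sqrt{\tfrac{p-1}{q-1}}\Big)\,\|f\|_{L_q(\{-1,1\}^n;X)},$$ where $T_d$ is the $d$-th Chebyshev polynomial of the first kind.
   Context: $\mathbb{N}=\{1,2,\ldots\}$. For $p\in[1,\infty)$, $\|f\|_{L_p(\{-1,1\}^n;X)}=\big(2^{-n}\sum_{\varepsilon\in\{-1,1\}^n}\|f(\varepsilon)\|_X^p\big)^{1/p}$. For $A\subseteq\{1,\ldots,n\}$, the Walsh function is $w_A(\varepsilon)=\prod_{i\in A}\varepsilon_i$. Every $f:\{-1,1\}^n\to X$ has the expansion $f=\sum_{A}\widehat f(A)w_A$ with $\widehat f(A)=2^{-n}\sum_{\delta\in\{-1,1\}^n}f(\delta)w_A(\delta)\in X$. A function $f$ has degree at most $d$ if $\widehat f(A)=0$ whenever $|A|>d$. $T_d$ is the unique polynomial of degree $d$ with $T_d(\cos\theta)=\cos(d\theta)$ for all real $\theta$. *)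

theory Defs
  imports "HOL-Analysis.Analysis" "HOL-Computational_Algebra.Polynomial"
begin

text \<open>
  A complex Banach space, presented as a real Banach space carrying a compatible multiplication by
  complex scalars for which the norm is homogeneous.
\<close>

class complex_banach = banach +
  fixes scaleC :: "complex \<Rightarrow> 'a \<Rightarrow> 'a"  (infixr "*\<^sub>C" 75)
  assumes scaleC_add_right: "c *\<^sub>C (x + y) = c *\<^sub>C x + c *\<^sub>C y"
    and scaleC_add_left: "(b + c) *\<^sub>C x = b *\<^sub>C x + c *\<^sub>C x"
    and scaleC_scaleC: "b *\<^sub>C c *\<^sub>C x = (b * c) *\<^sub>C x"
    and scaleC_of_real: "complex_of_real r *\<^sub>C x = r *\<^sub>R x"
    and norm_scaleC: "norm (c *\<^sub>C x) = cmod c * norm x"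

instantiation complex :: complex_banach
begin

definition scaleC_complex :: "complex \<Rightarrow> complex \<Rightarrow> complex" where
  "scaleC_complex = (*)"

instance
  by standard (auto simp: scaleC_complex_def algebra_simps norm_mult scaleR_conv_of_real)

end

text \<open>
  Points of the cube are functions on the naturals that take values in \<open>{-1, 1}\<close> on \<open>{1..n}\<close> and
  are \<open>undefined\<close> elsewhere. A function on the cube is given by any function on this ambient type;
  the notions below depend only on its values on the cube.
\<close>

definition cube :: "nat \<Rightarrow> (nat \<Rightarrow> real) set" where
  "cube n = {1..n} \<rightarrow>\<^sub>E {-1, 1}"

definition cube_norm :: "nat \<Rightarrow> real \<Rightarrow> ((nat \<Rightarrow> real) \<Rightarrow> 'a::real_normed_vector) \<Rightarrow> real" where
  "cube_norm n p f = ((\<Sum>\<epsilon>\<in>cube n. norm (f \<epsilon>) powr p) / 2 ^ n) powr (1 / p)"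

definition walsh :: "nat set \<Rightarrow> (nat \<Rightarrow> real) \<Rightarrow> real" where
  "walsh A \<epsilon> = (\<Prod>i\<in>A. \<epsilon> i)"

definition walsh_coeff ::
    "nat \<Rightarrow> ((nat \<Rightarrow> real) \<Rightarrow> 'a::real_normed_vector) \<Rightarrow> nat set \<Rightarrow> 'a" where
  "walsh_coeff n f A = (1 / 2 ^ n) *\<^sub>R (\<Sum>\<delta>\<in>cube n. walsh A \<delta> *\<^sub>R f \<delta>)"

definition degree_at_most ::
    "nat \<Rightarrow> nat \<Rightarrow> ((nat \<Rightarrow> real) \<Rightarrow> 'a::real_normed_vector) \<Rightarrow> bool" where
  "degree_at_most n d f \<longleftrightarrow> (\<forall>A\<subseteq>{1..n}. card A > d \<longrightarrow> walsh_coeff n f A = 0)"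

definition chebyshev_T :: "nat \<Rightarrow> real poly" where
  "chebyshev_T d = (THE P. degree P = d \<and> (\<forall>\<theta>. poly P (cos \<theta>) = cos (real d * \<theta>)))"

lemma chebyshev_T_exists:
  "\<exists>P :: real poly. degree P = d \<and> (\<forall>\<theta>. poly P (cos \<theta>) = cos (real d * \<theta>))"
proof -
  define R where "R d P \<longleftrightarrow> degree P = d \<and> (\<forall>\<theta>. poly P (cos \<theta>) = cos (real d * \<theta>))"
    for d and P :: "real poly"
  have "\<exists>P Q. R d P \<and> R (Suc d) Q"
  proof (induction d)
    case 0
    have "R 0 1" "R (Suc 0) [:0, 1:]" by (auto simp: R_def)
    then show ?case by blast
  next
    case (Suc d)
    then obtain P Q where P: "R d P" and Q: "R (Suc d) Q" by blast
    let ?S = "[:0, 2:] * Q - P"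
    have "Q \<noteq> 0" using Q by (auto simp: R_def)
    then have deg: "degree ([:0, 2:] * Q) = Suc (Suc d)"
      using Q by (subst degree_mult_eq) (auto simp: R_def)
    then have "degree ?S = Suc (Suc d)"
      using degree_add_eq_left[of "- P" "[:0, 2:] * Q"] P by (simp add: R_def)
    moreover have "poly ?S (cos \<theta>) = cos (real (Suc (Suc d)) * \<theta>)" for \<theta>
    proof -
      have a: "real (Suc (Suc d)) * \<theta> = real (Suc d) * \<theta> + \<theta>"
        and b: "real d * \<theta> = real (Suc d) * \<theta> - \<theta>"
        by (simp_all add: algebra_simps)
      have "poly ?S (cos \<theta>) = 2 * cos \<theta> * cos (real (Suc d) * \<theta>) - cos (real d * \<theta>)"
        using P Q by (simp add: R_def del: of_nat_Suc)
      then show ?thesis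
        unfolding a b cos_add cos_diff by (simp del: of_nat_Suc)
    qed
    ultimately have "R (Suc (Suc d)) ?S" by (simp add: R_def)
    with Q show ?case by blast
  qed
  then show ?thesis by (auto simp: R_def)
qed

lemma chebyshev_T_unique:
  fixes P Q :: "real poly"
  assumes "\<And>\<theta>. poly P (cos \<theta>) = cos (real d * \<theta>)" "\<And>\<theta>. poly Q (cos \<theta>) = cos (real d * \<theta>)"
  shows "P = Q"
proof (rule ccontr)
  assume "P \<noteq> Q"
  then have "finite {x. poly (P - Q) x = 0}" by (intro poly_roots_finite) simp
  moreover have "{-1..1} \<subseteq> {x. poly (P - Q) x = 0}"
  proof
    fix x :: real assume "x \<in> {-1..1}"
    then have "cos (arccos x) = x" by simp
    then show "x \<in> {x. poly (P - Q) x = 0}"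
      using assms(1)[of "arccos x"] assms(2)[of "arccos x"] by simp
  qed
  ultimately have "finite {-1..1::real}" by (rule rev_finite_subset)
  then show False by (simp add: infinite_Icc)
qed

lemma chebyshev_T:
  "degree (chebyshev_T d) = d" "poly (chebyshev_T d) (cos \<theta>) = cos (real d * \<theta>)"
proof -
  have "\<exists>!P :: real poly. degree P = d \<and> (\<forall>\<theta>. poly P (cos \<theta>) = cos (real d * \<theta>))"
    using chebyshev_T_exists[of d] chebyshev_T_unique[of _ d] by blast
  from theI'[OF this]
  show "degree (chebyshev_T d) = d" "poly (chebyshev_T d) (cos \<theta>) = cos (real d * \<theta>)"
    unfolding chebyshev_T_def by blast+
qed

end

theory Submission imports Defs
begin

text \<open>
  Write \<open>T\<^sub>r\<close> for the noise operator, which multiplies the Walsh coefficient of \<open>f\<close> at \<open>A\<close> by \<open>r\<^bsup>|A|\<^esup>\<close>. Two ingredients are combined: a bound for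
  \<open>T\<^sub>r\<close> with small \<open>r\<close>, and a way to recover \<open>f = T\<^sub>1 f\<close> from the functions \<open>T\<^sub>r f\<close> with small \<open>r\<close>.

  The bound is hypercontractivity (Bonami): \<open>T\<^sub>r\<close> is a contraction from \<open>L\<^sub>q\<close> to \<open>L\<^sub>p\<close> as soon as
  \<open>r\<^sup>2 (p - 1) \<le> q - 1\<close>, that is for all real \<open>r\<close> with \<open>|r| \<le> 1 / x\<close>, where
  \<open>x = sqrt ((p - 1) / (q - 1))\<close>. It holds for every normed target space because \<open>T\<^sub>r\<close> averages
  against a nonnegative kernel: pointwise \<open>\<parallel>T\<^sub>r f\<parallel> \<le> T\<^sub>r \<parallel>f\<parallel>\<close>, which reduces the bound to nonnegative
  scalar functions. For these, the inequality on a two-point space (\<open>two_point_hypercontractive\<close>) passes to the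
  cube by induction on the dimension, where Minkowski's inequality exchanges the norm in the last
  coordinate with the norm in the others (\<open>noise_hypercontractive\<close>).

  For the recovery, if \<open>f\<close> has degree at most \<open>d\<close> then \<open>r \<mapsto> T\<^sub>r f\<close> is a polynomial of degree at most
  \<open>d\<close> in \<open>r\<close>. Its value at \<open>1 = x \<cdot> (1 / x)\<close> is a combination, with weights \<open>c\<^sub>j\<close>, of its
  values at the scaled Chebyshev nodes \<open>cos (j \<pi> / d) / x\<close>. The weights alternate in sign exactly as the
  values of \<open>T\<^sub>d\<close> at the nodes do, hence \<open>\<Sum>\<^sub>j |c\<^sub>j| = T\<^sub>d(x)\<close> (\<open>chebyshev_extrapolation\<close>). The triangle
  inequality in \<open>L\<^sub>p\<close> finishes the proof.
\<close>

section \<open>The two-point inequality\<close>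

text \<open>
  The hypercontractive condition on the noise parameter keeps the averaging weights
  \<open>(1 \<plusminus> r) / 2\<close> positive.
\<close>

lemma abs_noise_less_1:
  fixes p q r :: real
  assumes "1 < q" "q < p" and r: "r\<^sup>2 * (p - 1) \<le> q - 1"
  shows "\<bar>r\<bar> < 1"
proof -
  have "r\<^sup>2 < 1"
  proof (rule ccontr)
    assume "\<not> r\<^sup>2 < 1"
    then have "1 * (p - 1) \<le> r\<^sup>2 * (p - 1)" using assms by (intro mult_right_mono) auto
    then have "1 * (p - 1) \<le> q - 1" using r by (rule order_trans)
    then show False using assms by simp
  qed
  then show ?thesis by (simp add: abs_square_less_1)
qed

text \<open>
  Passing from \<open>k\<close> to \<open>k + 1\<close> multiplies the two sides by factors proportional to
  \<open>r\<^sup>2 (m - p) (m + 1 - p)\<close> and \<open>(m - q) (m + 1 - q)\<close> with \<open>m = 2 (k + 1)\<close>. Because \<open>q < p \<le> 2 \<le> m\<close>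
  and \<open>r\<^sup>2 \<le> 1\<close>, both are nonnegative and the first is at most the second. At \<open>k = 0\<close> the
  claim is exactly the condition on \<open>r\<close>.
\<close>

lemma even_gbinomial_compare:
  fixes p q r :: real
  assumes "1 < q" "q < p" "p \<le> 2" and r: "r\<^sup>2 * (p - 1) \<le> q - 1"
  shows "0 \<le> (p gchoose (2 * Suc k)) * r ^ (2 * Suc k) \<and>
    (p gchoose (2 * Suc k)) * r ^ (2 * Suc k) \<le> p / q * (q gchoose (2 * Suc k))"
proof (induction k)
  case 0
  have "(a gchoose 2) = a * (a - 1) / 2" for a :: real
    using gbinomial_mult_1[of a 1] by (simp add: numeral_2_eq_2 field_simps)
  then have two: "(a gchoose (2 * Suc 0)) = a * (a - 1) / 2" for a :: real by simp
  have "p / 2 * (r\<^sup>2 * (p - 1)) \<le> p / 2 * (q - 1)" using assms by (intro mult_left_mono) auto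
  then have "p * (p - 1) / 2 * r\<^sup>2 \<le> p / q * (q * (q - 1) / 2)"
    using assms by (simp add: mult_ac)
  moreover have "0 \<le> p * (p - 1) / 2 * r\<^sup>2" using assms by simp
  moreover have "r ^ (2 * Suc 0) = r\<^sup>2" by simp
  ultimately show ?case unfolding two by metis
next
  case (Suc k)
  define m where "m = real (2 * Suc k)"
  have m: "m \<ge> 2" by (simp add: m_def)
  define D where "D = (m + 1) * (m + 2)"
  have "D > 0" using m by (simp add: D_def)
  have step1: "(a gchoose Suc j) = (a gchoose j) * (a - j) / (real j + 1)" for a :: real and j
    using gbinomial_mult_1[of a j] by (simp add: field_simps)
  have step: "(a gchoose (2 * Suc (Suc k))) = (a gchoose (2 * Suc k)) * ((m - a) * (m + 1 - a) / D)"
    for a :: real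
  proof -
    have e: "2 * Suc (Suc k) = Suc (Suc (2 * Suc k))" "real (Suc (2 * Suc k)) = m + 1"
      "real (2 * Suc k) = m"
      by (simp_all add: m_def)
    have "(a gchoose (2 * Suc (Suc k)))
        = (a gchoose (2 * Suc k)) * (a - m) / (m + 1) * (a - (m + 1)) / (m + 1 + 1)"
      unfolding e(1) step1 e(2,3) ..
    moreover have "(a - m) * (a - (m + 1)) = (m - a) * (m + 1 - a)"
      by (simp add: algebra_simps)
    moreover have "m + 1 + 1 = m + 2" by simp
    ultimately show ?thesis by (metis D_def times_divide_times_eq times_divide_eq_right
          divide_divide_eq_left mult.assoc)
  qed
  have "\<bar>r\<bar> < 1" using assms by (intro abs_noise_less_1)
  then have r1: "r\<^sup>2 \<le> 1" by (simp add: abs_square_le_1)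
  define \<alpha> \<beta> where "\<alpha> = r\<^sup>2 * ((m - p) * (m + 1 - p) / D)" and "\<beta> = (m - q) * (m + 1 - q) / D"
  have "(m - p) * (m + 1 - p) \<le> (m - q) * (m + 1 - q)"
    using assms m by (intro mult_mono) auto
  moreover have pos: "(m - p) * (m + 1 - p) / D \<ge> 0"
    using assms m \<open>D > 0\<close> by simp
  ultimately have "\<alpha> \<le> 1 * \<beta>"
    unfolding \<alpha>_def \<beta>_def using r1 \<open>D > 0\<close>
    by (intro mult_mono) (auto intro: divide_right_mono)
  moreover have "\<alpha> \<ge> 0" unfolding \<alpha>_def by (intro mult_nonneg_nonneg pos) auto
  ultimately have ab: "0 \<le> \<alpha>" "\<alpha> \<le> \<beta>" by auto
  have eq: "(p gchoose (2 * Suc (Suc k))) * r ^ (2 * Suc (Suc k))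
      = ((p gchoose (2 * Suc k)) * r ^ (2 * Suc k)) * \<alpha>"
    unfolding step \<alpha>_def by (simp add: power2_eq_square)
  have eq2: "p / q * (q gchoose (2 * Suc (Suc k))) = (p / q * (q gchoose (2 * Suc k))) * \<beta>"
    unfolding step \<beta>_def by simp
  note IH = conjunct1[OF Suc.IH] conjunct2[OF Suc.IH]
  show ?case
    unfolding eq eq2
    using mult_nonneg_nonneg[OF IH(1) ab(1)] mult_mono[OF IH(2) ab(2) order_trans[OF IH] ab(1)]
    by (rule conjI)
qed

lemma even_binomial_series:
  fixes a z :: real
  assumes "\<bar>z\<bar> < 1"
  shows "(\<lambda>n. if even n then (a gchoose n) * z ^ n else 0) sums
    (((1 + z) powr a + (1 - z) powr a) / 2)"
proof -
  have "(\<lambda>n. ((a gchoose n) * z ^ n + (a gchoose n) * (- z) ^ n) / 2) sums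
    (((1 + z) powr a + (1 + - z) powr a) / 2)"
    using assms by (intro sums_divide sums_add gen_binomial_real) auto
  moreover have "(\<lambda>n. ((a gchoose n) * z ^ n + (a gchoose n) * (- z) ^ n) / 2)
      = (\<lambda>n. if even n then (a gchoose n) * z ^ n else 0)"
    by (auto simp: fun_eq_iff)
  ultimately show ?thesis by simp
qed

text \<open>
  Young's inequality for the product \<open>x \<cdot> 1\<close> with exponents \<open>s\<close> and \<open>s / (s - 1)\<close>.
\<close>

lemma Bernoulli_powr:
  fixes s x :: real
  assumes "1 < s" "0 \<le> x"
  shows "1 + s * (x - 1) \<le> x powr s"
proof -
  have "x * 1 \<le> x powr s / s + 1 powr (s / (s - 1)) / (s / (s - 1))"
    using assms by (intro Youngs_inequality) (auto simp: field_simps)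
  also have "1 powr (s / (s - 1)) / (s / (s - 1)) = (s - 1) / s"
    using assms by simp
  also have "x powr s / s + (s - 1) / s = (x powr s + (s - 1)) / s"
    by (simp add: add_divide_distrib)
  finally have "x * s \<le> x powr s + (s - 1)"
    using assms by (simp add: pos_le_divide_eq)
  then show ?thesis by (simp add: algebra_simps)
qed

text \<open>
  Only even powers survive in both binomial series. They are compared term by term after
  \<open>E\<^bsup>p / q\<^esup>\<close> on the right is bounded below by \<open>1 + (p / q) (E - 1)\<close>, its tangent at \<open>E = 1\<close>. This
  inserts the factor \<open>p / q\<close> in front of the higher terms and leaves both constant terms equal to 1.
\<close>

lemma two_point_series:
  fixes p q r z :: real
  assumes "1 < q" "q < p" "p \<le> 2" and r: "r\<^sup>2 * (p - 1) \<le> q - 1" and z: "\<bar>z\<bar> < 1"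
  shows "((1 + r * z) powr p + (1 - r * z) powr p) / 2
    \<le> (((1 + z) powr q + (1 - z) powr q) / 2) powr (p / q)"
proof -
  define E where "E a z = ((1 + z) powr a + (1 - z) powr a) / 2" for a z :: real
  have "\<bar>r\<bar> < 1" using assms by (intro abs_noise_less_1)
  then have "\<bar>r\<bar> * \<bar>z\<bar> \<le> 1 * \<bar>z\<bar>" by (intro mult_right_mono) auto
  then have rz: "\<bar>r * z\<bar> < 1" using z by (simp add: abs_mult)
  let ?c = "\<lambda>a z n. if even n then (a gchoose n) * z ^ n else 0 :: real"
  have 1: "?c p (r * z) sums E p (r * z)" and 2: "?c q z sums E q z"
    unfolding E_def by (intro even_binomial_series rz z)+
  \<comment> \<open>The constant term \<open>1 - p / q\<close> is carried by the coefficient of index 0.\<close>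
  have "(\<lambda>n. p / q * ?c q z n + (if n = 0 then 1 - p / q else 0)) sums (p / q * E q z + (1 - p / q))"
    by (intro sums_add sums_mult 2 sums_single)
  moreover have "?c p (r * z) n \<le> p / q * ?c q z n + (if n = 0 then 1 - p / q else 0)" for n
  proof (cases "even n \<and> n \<noteq> 0")
    case True
    then obtain k where n: "n = 2 * Suc k"
      by (metis dvdE mult_0_right not0_implies_Suc)
    have "0 \<le> z ^ n" using True by (simp add: zero_le_even_power)
    then have "((p gchoose n) * r ^ n) * z ^ n \<le> (p / q * (q gchoose n)) * z ^ n"
      using even_gbinomial_compare[OF assms(1-4), of k] unfolding n
      by (intro mult_right_mono) auto
    then show ?thesis using True by (simp add: power_mult_distrib mult_ac)
  qed auto
  ultimately have "E p (r * z) \<le> p / q * E q z + (1 - p / q)"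
    by (intro sums_le[OF _ 1]) auto
  also have "\<dots> = 1 + p / q * (E q z - 1)" by (simp add: algebra_simps)
  also have "\<dots> \<le> E q z powr (p / q)"
    using assms by (intro Bernoulli_powr) (auto simp: E_def)
  finally show ?thesis by (simp add: E_def)
qed

definition two_norm :: "real \<Rightarrow> real \<Rightarrow> real \<Rightarrow> real" where
  "two_norm p u v = ((u powr p + v powr p) / 2) powr (1 / p)"

text \<open>
  Contractivity of the noise operator on a two-point space, where a function is the pair \<open>(u, v)\<close>
  of its values. Strict positivity makes the duality argument below free of
  degenerate cases; the boundary is reached by continuity.
\<close>

definition two_contractive :: "real \<Rightarrow> real \<Rightarrow> real \<Rightarrow> bool" where
  "two_contractive r q p \<longleftrightarrow> (\<forall>u>0. \<forall>v>0.
     two_norm p ((1 + r) / 2 * u + (1 - r) / 2 * v) ((1 - r) / 2 * u + (1 + r) / 2 * v)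
       \<le> two_norm q u v)"

lemma two_norm_scale:
  assumes "c \<ge> 0" "u \<ge> 0" "v \<ge> 0" "p > 0"
  shows "two_norm p (c * u) (c * v) = c * two_norm p u v"
proof -
  have "((c * u) powr p + (c * v) powr p) / 2 = c powr p * ((u powr p + v powr p) / 2)"
    using assms by (simp add: powr_mult algebra_simps)
  then have "two_norm p (c * u) (c * v) = (c powr p * ((u powr p + v powr p) / 2)) powr (1 / p)"
    by (simp only: two_norm_def)
  also have "\<dots> = (c powr p) powr (1 / p) * two_norm p u v"
    using assms by (simp only: two_norm_def powr_mult)
  also have "(c powr p) powr (1 / p) = c"
    using assms by (simp add: powr_powr)
  finally show ?thesis .
qed

text \<open>
  By homogeneity the mean of the two values can be normalised to 1, which turns the pair into
  \<open>(1 + z, 1 - z)\<close> and its image under the noise operator into \<open>(1 + r z, 1 - r z)\<close>.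
\<close>

lemma two_contractive_le_2:
  fixes p q r :: real
  assumes "1 < q" "q < p" "p \<le> 2" and r: "r\<^sup>2 * (p - 1) \<le> q - 1"
  shows "two_contractive r q p"
  unfolding two_contractive_def
proof (intro allI impI)
  fix u v :: real assume uv: "u > 0" "v > 0"
  define x z where "x = (u + v) / 2" and "z = (u - v) / (u + v)"
  have x: "x > 0" using uv by (simp add: x_def)
  have "\<bar>z\<bar> < 1" using uv by (auto simp: z_def abs_less_iff field_simps)
  have xz: "x * z = (u - v) / 2" using uv by (auto simp: x_def z_def field_simps)
  have u: "u = x * (1 + z)" and v: "v = x * (1 - z)"
    using xz by (auto simp: ring_distribs x_def field_simps)
  have Tu: "(1 + r) / 2 * u + (1 - r) / 2 * v = x * (1 + r * z)"
    and Tv: "(1 - r) / 2 * u + (1 + r) / 2 * v = x * (1 - r * z)"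
    unfolding u v by (simp_all add: field_simps)
  have "\<bar>r\<bar> < 1" using assms by (intro abs_noise_less_1)
  then have "\<bar>r\<bar> * \<bar>z\<bar> < 1 * 1" using \<open>\<bar>z\<bar> < 1\<close> by (intro mult_strict_mono') auto
  then have rz: "\<bar>r * z\<bar> < 1" by (simp add: abs_mult)
  have "two_norm p (1 + r * z) (1 - r * z)
      \<le> ((((1 + z) powr q + (1 - z) powr q) / 2) powr (p / q)) powr (1 / p)"
    unfolding two_norm_def using assms \<open>\<bar>z\<bar> < 1\<close>
    by (intro powr_mono2 two_point_series) auto
  also have "\<dots> = two_norm q (1 + z) (1 - z)"
    using assms by (simp add: two_norm_def powr_powr)
  finally show "two_norm p ((1 + r) / 2 * u + (1 - r) / 2 * v) ((1 - r) / 2 * u + (1 + r) / 2 * v)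
       \<le> two_norm q u v"
    unfolding Tu Tv unfolding u v using x \<open>\<bar>z\<bar> < 1\<close> rz assms
    by (subst (1 2) two_norm_scale) auto
qed

lemma two_norm_nonneg: "two_norm p u v \<ge> 0"
  by (simp add: two_norm_def)

lemma two_norm_mono:
  assumes "p > 0" "0 \<le> u" "u \<le> u'" "0 \<le> v" "v \<le> v'"
  shows "two_norm p u v \<le> two_norm p u' v'"
  unfolding two_norm_def using assms
  by (intro powr_mono2 divide_right_mono add_mono) auto

lemma two_norm_pos: "u > 0 \<Longrightarrow> v > 0 \<Longrightarrow> two_norm p u v > 0"
  by (simp add: two_norm_def add_pos_pos less_imp_neq[THEN not_sym])

lemma two_norm_powr: "p \<noteq> 0 \<Longrightarrow> two_norm p u v powr p = (u powr p + v powr p) / 2"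
  by (simp add: two_norm_def powr_powr add_nonneg_nonneg)

text \<open>
  After both norms are normalised to 1, this is the average of two instances of Young's inequality.
\<close>

lemma two_Hoelder:
  fixes p q :: real
  assumes "1 < p" "1 < q" "1 / p + 1 / q = 1" "u > 0" "v > 0" "s > 0" "t > 0"
  shows "(u * s + v * t) / 2 \<le> two_norm p u v * two_norm q s t"
proof -
  define a b where "a = two_norm p u v" and "b = two_norm q s t"
  have ab: "a > 0" "b > 0" unfolding a_def b_def using assms by (auto intro: two_norm_pos)
  have a: "(u / a) powr p + (v / a) powr p = 2" and b: "(s / b) powr q + (t / b) powr q = 2"
    using two_norm_powr[of p u v] two_norm_powr[of q s t] assms ab
    by (auto simp: powr_divide field_simps simp flip: a_def b_def)
  have "(u / a) * (s / b) + (v / a) * (t / b)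
    \<le> ((u / a) powr p / p + (s / b) powr q / q) + ((v / a) powr p / p + (t / b) powr q / q)"
    using assms ab by (intro add_mono Youngs_inequality) auto
  also have "\<dots> = ((u / a) powr p + (v / a) powr p) / p + ((s / b) powr q + (t / b) powr q) / q"
    by (simp add: add_divide_distrib)
  also have "\<dots> = 2" unfolding a b using assms by (simp add: field_simps)
  finally have "(u / a) * (s / b) + (v / a) * (t / b) \<le> 2" .
  then show ?thesis
    using ab by (simp add: field_simps flip: a_def b_def)
qed

text \<open>
  The noise operator \<open>T\<close> is symmetric, so a bound from \<open>L\<^bsub>p'\<^esub>\<close> to \<open>L\<^bsub>q'\<^esub>\<close>, with conjugate exponents \<open>p'\<close>
  and \<open>q'\<close>, gives one from \<open>L\<^sub>q\<close> to \<open>L\<^sub>p\<close>. Concretely, pair \<open>T f\<close> with \<open>g = (T f)\<^bsup>p - 1\<^esup>\<close>, which is the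
  extremal function in Hoelder's inequality:
  \<open>\<parallel>T f\<parallel>\<^sub>p\<^bsup>p\<^esup> = \<langle>T f, g\<rangle> = \<langle>f, T g\<rangle> \<le> \<parallel>f\<parallel>\<^sub>q \<parallel>T g\<parallel>\<^bsub>q'\<^esub> \<le> \<parallel>f\<parallel>\<^sub>q \<parallel>g\<parallel>\<^bsub>p'\<^esub> = \<parallel>f\<parallel>\<^sub>q \<parallel>T f\<parallel>\<^sub>p\<^bsup>p - 1\<^esup>\<close>.
\<close>

lemma two_contractive_dual:
  fixes p q r :: real
  assumes pq: "1 < q" "1 < p" and r: "\<bar>r\<bar> < 1"
    and dual: "two_contractive r (p / (p - 1)) (q / (q - 1))"
  shows "two_contractive r q p"
  unfolding two_contractive_def
proof (intro allI impI)
  fix u v :: real assume uv: "u > 0" "v > 0"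
  define a b where "a = (1 + r) / 2" and "b = (1 - r) / 2"
  have ab: "a > 0" "b > 0" using r by (auto simp: a_def b_def)
  define U V where "U = a * u + b * v" and "V = b * u + a * v"
  have UV: "U > 0" "V > 0" using ab uv by (auto simp: U_def V_def add_pos_pos)
  define s t where "s = U powr (p - 1)" and "t = V powr (p - 1)"
  have st: "s > 0" "t > 0" using UV by (auto simp: s_def t_def)
  let ?p = "p / (p - 1)" and ?q = "q / (q - 1)"
  define N where "N = two_norm p U V"
  have N: "N > 0" using UV by (simp add: N_def two_norm_pos)
  have Np: "N powr p = (U powr p + V powr p) / 2"
    unfolding N_def using pq by (simp add: two_norm_powr)
  have "two_norm ?p s t = ((U powr p + V powr p) / 2) powr ((p - 1) / p)"
    using pq by (simp add: two_norm_def s_def t_def powr_powr)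
  also have "\<dots> = N powr (p - 1)"
    using pq by (simp add: powr_powr flip: Np)
  finally have Nst: "two_norm ?p s t = N powr (p - 1)" .
  have m: "x powr p = x * x powr (p - 1)" if "x > 0" for x :: real
    using that by (simp add: powr_diff)
  \<comment> \<open>Symmetry moves the operator from the first factor to the second.\<close>
  have "N powr p = (U * s + V * t) / 2"
    unfolding Np using UV by (simp add: s_def t_def m)
  also have "\<dots> = (u * (a * s + b * t) + v * (b * s + a * t)) / 2"
    by (simp add: U_def V_def algebra_simps)
  also have "\<dots> \<le> two_norm q u v * two_norm ?q (a * s + b * t) (b * s + a * t)"
    using pq uv ab st by (intro two_Hoelder) (auto simp: field_simps add_pos_pos)
  also have "\<dots> \<le> two_norm q u v * two_norm ?p s t"
    using dual st uv two_norm_pos[of u v q] unfolding two_contractive_def a_def b_def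
    by (intro mult_left_mono) auto
  finally have "N * N powr (p - 1) \<le> two_norm q u v * N powr (p - 1)"
    using N by (simp add: m Nst)
  then have "N \<le> two_norm q u v"
    using N by simp
  then show "two_norm p ((1 + r) / 2 * u + (1 - r) / 2 * v) ((1 - r) / 2 * u + (1 + r) / 2 * v)
       \<le> two_norm q u v"
    by (simp add: N_def U_def V_def a_def b_def)
qed

text \<open>
  Conjugation maps the range \<open>2 \<le> q < p\<close> to \<open>1 < p' < q' \<le> 2\<close>. It preserves the condition on \<open>r\<close>, because
  \<open>p' - 1 = 1 / (p - 1)\<close>.
\<close>

lemma two_contractive_ge_2:
  fixes p q r :: real
  assumes "2 \<le> q" "q < p" and r: "r\<^sup>2 * (p - 1) \<le> q - 1"
  shows "two_contractive r q p"
proof (rule two_contractive_dual)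
  show "two_contractive r (p / (p - 1)) (q / (q - 1))"
    using assms by (intro two_contractive_le_2) (auto simp: field_simps)
  show "\<bar>r\<bar> < 1" using assms by (intro abs_noise_less_1) auto
qed (use assms in auto)

text \<open>
  Noise parameters multiply under composition, so two steps through an intermediate exponent suffice.
\<close>

lemma two_contractive_comp:
  assumes "two_contractive r q m" "two_contractive s m p" "\<bar>r\<bar> < 1"
  shows "two_contractive (s * r) q p"
  unfolding two_contractive_def
proof (intro allI impI)
  fix u v :: real assume uv: "u > 0" "v > 0"
  define U V where "U = (1 + r) / 2 * u + (1 - r) / 2 * v" and "V = (1 - r) / 2 * u + (1 + r) / 2 * v"
  have UV: "U > 0" "V > 0" using assms(3) uv by (auto simp: U_def V_def add_pos_pos)
  have "(1 + s * r) / 2 * u + (1 - s * r) / 2 * v = (1 + s) / 2 * U + (1 - s) / 2 * V"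
       "(1 - s * r) / 2 * u + (1 + s * r) / 2 * v = (1 - s) / 2 * U + (1 + s) / 2 * V"
    by (simp_all add: U_def V_def field_simps)
  then have "two_norm p ((1 + s * r) / 2 * u + (1 - s * r) / 2 * v)
      ((1 - s * r) / 2 * u + (1 + s * r) / 2 * v) \<le> two_norm m U V"
    using assms(2) UV by (simp add: two_contractive_def)
  also have "\<dots> \<le> two_norm q u v"
    using assms(1) uv by (simp add: two_contractive_def U_def V_def)
  finally show "two_norm p ((1 + s * r) / 2 * u + (1 - s * r) / 2 * v)
      ((1 - s * r) / 2 * u + (1 + s * r) / 2 * v) \<le> two_norm q u v" .
qed

text \<open>
  When 2 lies between the exponents, go from \<open>L\<^sub>q\<close> to \<open>L\<^sub>2\<close> with the extremal parameter \<open>sqrt (q - 1)\<close>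
  and from \<open>L\<^sub>2\<close> to \<open>L\<^sub>p\<close> with the remaining factor of \<open>r\<close>.
\<close>

lemma two_contractive_general:
  fixes p q r :: real
  assumes "1 < q" "q < p" and r: "r\<^sup>2 * (p - 1) \<le> q - 1"
  shows "two_contractive r q p"
proof -
  consider "p \<le> 2" | "2 \<le> q" | "q < 2" "2 < p" by linarith
  then show ?thesis
  proof cases
    case 3
    define a where "a = sqrt (q - 1)"
    have a: "a\<^sup>2 = q - 1" "a > 0" using assms by (auto simp: a_def)
    have "\<bar>a\<bar> < 1" using 3 assms by (intro abs_noise_less_1[of q 2]) (auto simp: a)
    moreover have "two_contractive a q 2"
      using 3 assms by (intro two_contractive_le_2) (auto simp: a)
    moreover have "two_contractive (r / a) 2 p"
      using 3 assms a by (intro two_contractive_ge_2) (auto simp: power_divide field_simps)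
    ultimately have "two_contractive (r / a * a) q p" by (intro two_contractive_comp)
    then show ?thesis using a by simp
  qed (use assms in \<open>auto intro: two_contractive_le_2 two_contractive_ge_2\<close>)
qed

lemma two_norm_tendsto:
  assumes "p > 0" "(f \<longlongrightarrow> u) F" "(g \<longlongrightarrow> v) F" "eventually (\<lambda>x. f x > 0 \<and> g x > 0) F"
  shows "((\<lambda>x. two_norm p (f x) (g x)) \<longlongrightarrow> two_norm p u v) F"
  unfolding two_norm_def using assms
  by (intro tendsto_powr' tendsto_divide tendsto_add tendsto_const)
     (auto elim!: eventually_mono simp: add_nonneg_nonneg)

text \<open>
  Zero values are approximated by adding a small positive constant to both.
\<close>

lemma two_point_hypercontractive:
  fixes p q r :: real
  assumes pq: "1 < q" "q < p" and r: "r\<^sup>2 * (p - 1) \<le> q - 1" and uv: "u \<ge> 0" "v \<ge> 0"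
  shows "two_norm p ((1 + r) / 2 * u + (1 - r) / 2 * v) ((1 - r) / 2 * u + (1 + r) / 2 * v)
       \<le> two_norm q u v"
proof -
  have r1: "\<bar>r\<bar> < 1" using assms by (intro abs_noise_less_1)
  have lim: "((\<lambda>e. w + e) \<longlongrightarrow> w) (at_right 0)" for w :: real
    using tendsto_add[OF tendsto_const[of w] tendsto_ident_at[of 0 "{0<..}"]] by simp
  have pos: "eventually (\<lambda>e. u + e > 0 \<and> v + e > 0) (at_right (0::real))"
    using eventually_at_right_less by eventually_elim (use uv in auto)
  show ?thesis
  proof (rule tendsto_le)
    show "((\<lambda>e. two_norm q (u + e) (v + e)) \<longlongrightarrow> two_norm q u v) (at_right 0)"
      using pq pos by (intro two_norm_tendsto lim) auto
    show "((\<lambda>e. two_norm p ((1 + r) / 2 * (u + e) + (1 - r) / 2 * (v + e))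
        ((1 - r) / 2 * (u + e) + (1 + r) / 2 * (v + e))) \<longlongrightarrow>
        two_norm p ((1 + r) / 2 * u + (1 - r) / 2 * v) ((1 - r) / 2 * u + (1 + r) / 2 * v)) (at_right 0)"
      using pq pos r1 by (intro two_norm_tendsto tendsto_intros lim)
        (auto elim!: eventually_mono intro!: add_pos_pos)
    show "eventually (\<lambda>e. two_norm p ((1 + r) / 2 * (u + e) + (1 - r) / 2 * (v + e))
        ((1 - r) / 2 * (u + e) + (1 + r) / 2 * (v + e)) \<le> two_norm q (u + e) (v + e)) (at_right 0)"
      using pos two_contractive_general[OF pq r]
      by (auto elim!: eventually_mono simp: two_contractive_def)
  qed simp
qed

section \<open>Norms of functions on the cube\<close>

lemma finite_cube [simp]: "finite (cube n)"
  by (simp add: cube_def finite_PiE)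

lemma cube_0: "cube 0 = {\<lambda>_. undefined}"
  by (simp add: cube_def)

lemma cube_value: "\<epsilon> \<in> cube n \<Longrightarrow> i \<in> {1..n} \<Longrightarrow> \<epsilon> i = -1 \<or> \<epsilon> i = 1"
  by (fastforce simp: cube_def PiE_def Pi_def)

lemma sum_cube_Suc:
  fixes F :: "(nat \<Rightarrow> real) \<Rightarrow> 'b::comm_monoid_add"
  shows "(\<Sum>\<epsilon>\<in>cube (Suc n). F \<epsilon>)
    = (\<Sum>\<epsilon>\<in>cube n. F (\<epsilon>(Suc n := 1)) + F (\<epsilon>(Suc n := -1)))"
proof -
  have "(\<Sum>\<epsilon>\<in>cube (Suc n). F \<epsilon>) = (\<Sum>(s, \<epsilon>)\<in>{-1, 1::real} \<times> cube n. F (\<epsilon>(Suc n := s)))"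
    by (rule sum.reindex_bij_witness[of _ "\<lambda>(s, \<epsilon>). \<epsilon>(Suc n := s)"
          "\<lambda>\<epsilon>. (\<epsilon> (Suc n), \<epsilon>(Suc n := undefined))"])
       (auto simp: cube_def PiE_def extensional_def Pi_def le_Suc_eq fun_eq_iff)
  also have "\<dots> = (\<Sum>s\<in>{-1, 1::real}. \<Sum>\<epsilon>\<in>cube n. F (\<epsilon>(Suc n := s)))"
    by (simp add: sum.cartesian_product)
  also have "\<dots> = (\<Sum>\<epsilon>\<in>cube n. F (\<epsilon>(Suc n := 1)) + F (\<epsilon>(Suc n := -1)))"
    by (simp add: sum.distrib add.commute)
  finally show ?thesis .
qed

lemma cube_norm_nonneg: "cube_norm n p f \<ge> 0"
  by (simp add: cube_norm_def)

lemma cube_norm_powr: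
  "p > 0 \<Longrightarrow> cube_norm n p f powr p = (\<Sum>\<epsilon>\<in>cube n. norm (f \<epsilon>) powr p) / 2 ^ n"
  by (simp add: cube_norm_def powr_powr sum_nonneg)

lemma cube_norm_mono:
  assumes "p > 0" "\<And>\<epsilon>. \<epsilon> \<in> cube n \<Longrightarrow> norm (f \<epsilon>) \<le> norm (g \<epsilon>)"
  shows "cube_norm n p f \<le> cube_norm n p g"
  unfolding cube_norm_def using assms
  by (intro powr_mono2 divide_right_mono sum_mono divide_nonneg_nonneg sum_nonneg) auto

lemma cube_norm_cong:
  assumes "\<And>\<epsilon>. \<epsilon> \<in> cube n \<Longrightarrow> norm (f \<epsilon>) = norm (g \<epsilon>)"
  shows "cube_norm n p f = cube_norm n p g"
  unfolding cube_norm_def using assms by simp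

lemma cube_norm_scaleR:
  assumes "p > 0"
  shows "cube_norm n p (\<lambda>\<epsilon>. c *\<^sub>R f \<epsilon>) = \<bar>c\<bar> * cube_norm n p f"
proof -
  have "(\<Sum>\<epsilon>\<in>cube n. norm (c *\<^sub>R f \<epsilon>) powr p) / 2 ^ n
      = \<bar>c\<bar> powr p * ((\<Sum>\<epsilon>\<in>cube n. norm (f \<epsilon>) powr p) / 2 ^ n)"
    by (simp add: powr_mult sum_distrib_left)
  then have "cube_norm n p (\<lambda>\<epsilon>. c *\<^sub>R f \<epsilon>) = (\<bar>c\<bar> powr p) powr (1 / p) * cube_norm n p f"
    by (simp only: cube_norm_def powr_mult)
  then show ?thesis using assms by (simp add: powr_powr)
qed

text \<open>
  Extends the convexity of \<open>x \<mapsto> x powr p\<close> from positive reals to 0, since a function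
  may vanish at some points of the cube.
\<close>

lemma powr_convex_nonneg:
  fixes p t x y :: real
  assumes "1 \<le> p" "0 \<le> x" "0 \<le> y" "0 \<le> t" "t \<le> 1"
  shows "(t * x + (1 - t) * y) powr p \<le> t * x powr p + (1 - t) * y powr p"
proof -
  have zero: "(s * z) powr p \<le> s * z powr p" if "0 \<le> s" "s \<le> 1" "0 \<le> z" for s z :: real
  proof -
    have "s powr p \<le> s"
      using powr_mono'[of 1 p s] that assms by (cases "s = 0") auto
    then show ?thesis using that by (simp add: powr_mult mult_right_mono)
  qed
  consider "x = 0" | "y = 0" | "x > 0" "y > 0" using assms by linarith
  then show ?thesis
  proof cases
    case 1
    then show ?thesis using zero[of "1 - t" y] assms by simp
  next
    case 2
    then show ?thesis using zero[of t x] assms by simp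
  next
    case 3
    then show ?thesis
      using convex_onD[OF powr_convex[OF assms(1)], of "1 - t" x y] assms by simp
  qed
qed

text \<open>
  Minkowski's inequality. If \<open>a\<close> and \<open>b\<close> are positive upper bounds for the norms of \<open>f\<close> and \<open>g\<close>, then
  \<open>(|f| + |g|) / (a + b)\<close> is a convex combination of \<open>|f| / a\<close> and \<open>|g| / b\<close>, so the mean of its \<open>p\<close>-th
  power is at most 1 by convexity. Allowing arbitrary bounds rather than the norms themselves avoids
  division by zero; afterwards \<open>a\<close> and \<open>b\<close> decrease to the norms.
\<close>

lemma cube_norm_triangle:
  assumes p: "1 \<le> p"
  shows "cube_norm n p (\<lambda>\<epsilon>. f \<epsilon> + g \<epsilon>) \<le> cube_norm n p f + cube_norm n p g"
proof -
  have bound: "cube_norm n p (\<lambda>\<epsilon>. f \<epsilon> + g \<epsilon>) \<le> a + b"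
    if a: "cube_norm n p f \<le> a" "0 < a" and b: "cube_norm n p g \<le> b" "0 < b" for a b
  proof -
    define t where "t = a / (a + b)"
    have t: "0 \<le> t" "t \<le> 1" using a b by (auto simp: t_def)
    have t': "1 - t = b / (a + b)" using a b by (simp add: t_def field_simps)
    have ta: "t * (u / a) + (1 - t) * (v / b) = (u + v) / (a + b)" for u v
      unfolding t' using a b by (simp add: t_def add_divide_distrib)
    have point: "norm (f \<epsilon> + g \<epsilon>) powr p / (a + b) powr p
        \<le> t * (norm (f \<epsilon>) powr p / a powr p) + (1 - t) * (norm (g \<epsilon>) powr p / b powr p)" for \<epsilon>
    proof -
      have "norm (f \<epsilon> + g \<epsilon>) powr p / (a + b) powr p = (norm (f \<epsilon> + g \<epsilon>) / (a + b)) powr p"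
        using a b by (simp add: powr_divide)
      also have "\<dots> \<le> ((norm (f \<epsilon>) + norm (g \<epsilon>)) / (a + b)) powr p"
        using a b p by (intro powr_mono2 divide_right_mono norm_triangle_ineq) auto
      also have "\<dots> = (t * (norm (f \<epsilon>) / a) + (1 - t) * (norm (g \<epsilon>) / b)) powr p"
        by (simp only: ta)
      also have "\<dots> \<le> t * (norm (f \<epsilon>) / a) powr p + (1 - t) * (norm (g \<epsilon>) / b) powr p"
        using t a b p by (intro powr_convex_nonneg) auto
      finally show ?thesis using a b by (simp add: powr_divide)
    qed
    define S where "S h = (\<Sum>\<epsilon>\<in>cube n. norm (h \<epsilon>) powr p) / 2 ^ n" for h :: "(nat \<Rightarrow> real) \<Rightarrow> 'a"
    have S: "S h / c powr p \<le> 1" if "cube_norm n p h \<le> c" "0 < c" for h c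
    proof -
      have "S h \<le> c powr p"
        unfolding S_def using that p by (subst cube_norm_powr[symmetric])
          (auto intro!: powr_mono2 simp: cube_norm_nonneg)
      then show ?thesis using that by simp
    qed
    have "S (\<lambda>\<epsilon>. f \<epsilon> + g \<epsilon>) / (a + b) powr p
        = (\<Sum>\<epsilon>\<in>cube n. norm (f \<epsilon> + g \<epsilon>) powr p / (a + b) powr p) / 2 ^ n"
      by (simp add: S_def sum_divide_distrib mult.commute)
    also have "\<dots> \<le> (\<Sum>\<epsilon>\<in>cube n. t * (norm (f \<epsilon>) powr p / a powr p)
        + (1 - t) * (norm (g \<epsilon>) powr p / b powr p)) / 2 ^ n"
      by (intro divide_right_mono sum_mono point) auto
    also have "\<dots> = t * (S f / a powr p) + (1 - t) * (S g / b powr p)"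
      by (simp add: S_def sum.distrib add_divide_distrib sum_divide_distrib sum_distrib_left mult_ac)
    also have "\<dots> \<le> t * 1 + (1 - t) * 1"
      using t by (intro add_mono mult_left_mono S a b) auto
    finally have "S (\<lambda>\<epsilon>. f \<epsilon> + g \<epsilon>) \<le> (a + b) powr p"
      using a b by simp
    then have "S (\<lambda>\<epsilon>. f \<epsilon> + g \<epsilon>) powr (1 / p) \<le> ((a + b) powr p) powr (1 / p)"
      using p by (intro powr_mono2) (auto simp: S_def sum_nonneg)
    then show ?thesis using a b p by (simp add: S_def cube_norm_def powr_powr)
  qed
  show ?thesis
  proof (rule field_le_epsilon)
    fix e :: real assume "e > 0"
    then have "cube_norm n p (\<lambda>\<epsilon>. f \<epsilon> + g \<epsilon>) \<le> (cube_norm n p f + e / 2) + (cube_norm n p g + e / 2)"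
      using cube_norm_nonneg[of n p f] cube_norm_nonneg[of n p g] by (intro bound) auto
    then show "cube_norm n p (\<lambda>\<epsilon>. f \<epsilon> + g \<epsilon>) \<le> cube_norm n p f + cube_norm n p g + e" by simp
  qed
qed

lemma cube_norm_sum:
  assumes "1 \<le> p" "finite J"
  shows "cube_norm n p (\<lambda>\<epsilon>. \<Sum>j\<in>J. f j \<epsilon>) \<le> (\<Sum>j\<in>J. cube_norm n p (f j))"
  using assms(2)
proof (induction J rule: finite_induct)
  case empty
  then show ?case using assms by (simp add: cube_norm_def)
next
  case (insert j J)
  then show ?case
    using cube_norm_triangle[OF assms(1), of n "f j" "\<lambda>\<epsilon>. \<Sum>j\<in>J. f j \<epsilon>"] by simp
qed

text \<open>
  Fubini's theorem for the cube of dimension \<open>n + 1\<close>, in the form of an iterated norm.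
\<close>

lemma cube_norm_Suc:
  assumes "p > 0"
  shows "cube_norm (Suc n) p f
    = cube_norm n p (\<lambda>\<epsilon>. two_norm p (norm (f (\<epsilon>(Suc n := 1)))) (norm (f (\<epsilon>(Suc n := -1)))))"
proof -
  have "norm (two_norm p x y) powr p = (x powr p + y powr p) / 2" for x y
    using assms by (simp only: real_norm_def abs_of_nonneg[OF two_norm_nonneg] two_norm_powr)
  then have e: "(\<Sum>\<epsilon>\<in>cube n. norm (two_norm p (norm (f (\<epsilon>(Suc n := 1)))) (norm (f (\<epsilon>(Suc n := -1))))) powr p)
      = (\<Sum>\<epsilon>\<in>cube (Suc n). norm (f \<epsilon>) powr p) / 2"
    by (simp only: sum_cube_Suc sum_divide_distrib)
  show ?thesis
    unfolding cube_norm_def e by (simp add: mult.commute)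
qed

lemma cube_norm_powr_arg:
  assumes "p > 0" "s > 0" "\<And>\<epsilon>. g \<epsilon> \<ge> 0"
  shows "cube_norm n p (\<lambda>\<epsilon>. g \<epsilon> powr s) = cube_norm n (p * s) g powr s"
  using assms by (simp add: cube_norm_def powr_powr mult_ac)

text \<open>
  The iterated norm only increases when the larger exponent is moved inside. Raised to the power
  \<open>q\<close>, this is the triangle inequality for the exponent \<open>p / q \<ge> 1\<close> and the functions \<open>g\<^bsup>q\<^esup>\<close> and \<open>h\<^bsup>q\<^esup>\<close>.
\<close>

lemma Minkowski_mixed_norm:
  fixes g h :: "(nat \<Rightarrow> real) \<Rightarrow> real"
  assumes q: "1 \<le> q" "q \<le> p" and nonneg: "\<And>\<epsilon>. g \<epsilon> \<ge> 0" "\<And>\<epsilon>. h \<epsilon> \<ge> 0"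
  shows "cube_norm n p (\<lambda>\<epsilon>. two_norm q (g \<epsilon>) (h \<epsilon>)) \<le> two_norm q (cube_norm n p g) (cube_norm n p h)"
proof -
  have pw: "cube_norm n (p / q) (\<lambda>\<epsilon>. k \<epsilon> powr q) = cube_norm n p k powr q"
    if "\<And>\<epsilon>. k \<epsilon> \<ge> 0" for k :: "(nat \<Rightarrow> real) \<Rightarrow> real"
    using that q by (subst cube_norm_powr_arg) auto
  have "cube_norm n p (\<lambda>\<epsilon>. two_norm q (g \<epsilon>) (h \<epsilon>))
      = cube_norm n (p / q) (\<lambda>\<epsilon>. (g \<epsilon> powr q + h \<epsilon> powr q) / 2) powr (1 / q)"
    unfolding two_norm_def using q by (subst cube_norm_powr_arg) auto
  also have "\<dots> = cube_norm n (p / q) (\<lambda>\<epsilon>. (1 / 2) *\<^sub>R (g \<epsilon> powr q + h \<epsilon> powr q)) powr (1 / q)"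
    by simp
  also have "\<dots> = (1 / 2 * cube_norm n (p / q) (\<lambda>\<epsilon>. g \<epsilon> powr q + h \<epsilon> powr q)) powr (1 / q)"
    using q by (subst cube_norm_scaleR) auto
  also have "\<dots> \<le> (1 / 2 * (cube_norm n (p / q) (\<lambda>\<epsilon>. g \<epsilon> powr q)
      + cube_norm n (p / q) (\<lambda>\<epsilon>. h \<epsilon> powr q))) powr (1 / q)"
    using q by (intro powr_mono2 mult_left_mono cube_norm_triangle) (auto simp: cube_norm_nonneg)
  also have "\<dots> = two_norm q (cube_norm n p g) (cube_norm n p h)"
    using nonneg by (simp add: pw two_norm_def)
  finally show ?thesis .
qed

section \<open>The noise operator\<close>

text \<open>
  The kernel form makes positivity and the product structure visible; \<open>noise_walsh\<close> gives the
  equivalent Fourier multiplier form.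
\<close>

definition noise ::
    "real \<Rightarrow> nat \<Rightarrow> ((nat \<Rightarrow> real) \<Rightarrow> 'a::real_normed_vector) \<Rightarrow> (nat \<Rightarrow> real) \<Rightarrow> 'a" where
  "noise r n f \<epsilon> = (\<Sum>\<delta>\<in>cube n. (\<Prod>i\<in>{1..n}. (1 + r * \<epsilon> i * \<delta> i) / 2) *\<^sub>R f \<delta>)"

lemma noise_Suc:
  "noise r (Suc n) f (\<epsilon>(Suc n := s))
    = ((1 + r * s) / 2) *\<^sub>R noise r n (\<lambda>\<delta>. f (\<delta>(Suc n := 1))) \<epsilon>
      + ((1 - r * s) / 2) *\<^sub>R noise r n (\<lambda>\<delta>. f (\<delta>(Suc n := -1))) \<epsilon>"
proof -
  have "(\<Prod>i\<in>{1..Suc n}. (1 + r * (\<epsilon>(Suc n := s)) i * (\<delta>(Suc n := t)) i) / 2)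
      = (1 + r * s * t) / 2 * (\<Prod>i\<in>{1..n}. (1 + r * \<epsilon> i * \<delta> i) / 2)" for \<delta> t
    by (simp add: prod.nat_ivl_Suc' prod.cl_ivl_Suc)
  then show ?thesis
    unfolding noise_def sum_cube_Suc by (simp add: sum.distrib scaleR_sum_right mult_ac)
qed

lemma noise_kernel_nonneg:
  assumes "\<bar>r\<bar> \<le> 1" "\<epsilon> \<in> cube n" "\<delta> \<in> cube n"
  shows "(\<Prod>i\<in>{1..n}. (1 + r * \<epsilon> i * \<delta> i) / 2) \<ge> 0"
proof (intro prod_nonneg)
  fix i assume "i \<in> {1..n}"
  then have "\<epsilon> i = -1 \<or> \<epsilon> i = 1" "\<delta> i = -1 \<or> \<delta> i = 1" using assms cube_value by blast+
  then show "(1 + r * \<epsilon> i * \<delta> i) / 2 \<ge> 0" using assms(1) by auto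
qed

text \<open>
  Positivity of the kernel transfers scalar bounds to functions with values in any normed space.
\<close>

lemma norm_noise_le:
  assumes "\<bar>r\<bar> \<le> 1" "\<epsilon> \<in> cube n"
  shows "norm (noise r n f \<epsilon>) \<le> noise r n (\<lambda>\<delta>. norm (f \<delta>)) \<epsilon>"
  unfolding noise_def using noise_kernel_nonneg[OF assms]
  by (intro sum_norm_le) simp

text \<open>
  In the induction step, the two-point inequality handles the last coordinate for every value of the
  others, Minkowski's inequality moves the outer \<open>L\<^sub>p\<close> norm inside, and the induction hypothesis applies
  to the two restrictions of \<open>f\<close>.
\<close>

lemma noise_hypercontractive_nonneg:
  fixes f :: "(nat \<Rightarrow> real) \<Rightarrow> real"
  assumes pq: "1 < q" "q < p" and r: "r\<^sup>2 * (p - 1) \<le> q - 1" and f: "\<And>\<epsilon>. f \<epsilon> \<ge> 0"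
  shows "cube_norm n p (noise r n f) \<le> cube_norm n q f"
  using f
proof (induction n arbitrary: f)
  case 0
  then show ?case using pq by (simp add: cube_norm_def cube_0 noise_def powr_powr)
next
  case (Suc n)
  have r1: "\<bar>r\<bar> < 1" using assms by (intro abs_noise_less_1)
  define f1 f2 where "f1 = (\<lambda>\<delta>. f (\<delta>(Suc n := 1)))" and "f2 = (\<lambda>\<delta>. f (\<delta>(Suc n := -1)))"
  have f12: "f1 \<epsilon> \<ge> 0" "f2 \<epsilon> \<ge> 0" for \<epsilon> using Suc.prems by (simp_all add: f1_def f2_def)
  \<comment> \<open>Off the cube the kernel can be negative; absolute values make \<open>g\<close> and \<open>h\<close> nonnegative
    everywhere and change nothing on the cube.\<close>
  define g h where "g = (\<lambda>\<epsilon>. \<bar>noise r n f1 \<epsilon>\<bar>)" and "h = (\<lambda>\<epsilon>. \<bar>noise r n f2 \<epsilon>\<bar>)"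
  have gh: "noise r n f1 \<epsilon> = g \<epsilon>" "noise r n f2 \<epsilon> = h \<epsilon>" if "\<epsilon> \<in> cube n" for \<epsilon>
    using norm_noise_le[of r \<epsilon> n f1] norm_noise_le[of r \<epsilon> n f2] r1 that f12
    by (auto simp: g_def h_def)
  have nn: "g \<epsilon> \<ge> 0" "h \<epsilon> \<ge> 0" for \<epsilon> by (simp_all add: g_def h_def)
  have comb: "(1 + r) / 2 * g \<epsilon> + (1 - r) / 2 * h \<epsilon> \<ge> 0" "(1 - r) / 2 * g \<epsilon> + (1 + r) / 2 * h \<epsilon> \<ge> 0" for \<epsilon>
    using r1 nn[of \<epsilon>] by (auto intro!: add_nonneg_nonneg)
  have "cube_norm (Suc n) p (noise r (Suc n) f)
      = cube_norm n p (\<lambda>\<epsilon>. two_norm p ((1 + r) / 2 * g \<epsilon> + (1 - r) / 2 * h \<epsilon>)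
                                       ((1 - r) / 2 * g \<epsilon> + (1 + r) / 2 * h \<epsilon>))"
    using pq comb
    by (subst cube_norm_Suc) (auto intro!: cube_norm_cong simp: noise_Suc gh simp flip: f1_def f2_def)
  also have "\<dots> \<le> cube_norm n p (\<lambda>\<epsilon>. two_norm q (g \<epsilon>) (h \<epsilon>))"
    using pq nn two_point_hypercontractive[OF pq r]
    by (intro cube_norm_mono) (auto simp: two_norm_nonneg)
  also have "\<dots> \<le> two_norm q (cube_norm n p g) (cube_norm n p h)"
    using pq nn by (intro Minkowski_mixed_norm) auto
  also have "\<dots> = two_norm q (cube_norm n p (noise r n f1)) (cube_norm n p (noise r n f2))"
    by (simp add: g_def h_def cube_norm_def)
  also have "\<dots> \<le> two_norm q (cube_norm n q f1) (cube_norm n q f2)"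
    using pq f12 by (intro two_norm_mono Suc.IH) (auto simp: cube_norm_nonneg)
  also have "\<dots> = cube_norm (Suc n) q f"
  proof -
    have "two_norm q (cube_norm n q f1) (cube_norm n q f2)
        = (two_norm q (cube_norm n q f1) (cube_norm n q f2) powr q) powr (1 / q)"
      using pq by (simp add: powr_powr two_norm_nonneg)
    also have "two_norm q (cube_norm n q f1) (cube_norm n q f2) powr q
        = (\<Sum>\<epsilon>\<in>cube (Suc n). norm (f \<epsilon>) powr q) / 2 ^ Suc n"
      using pq by (simp add: two_norm_powr cube_norm_powr sum_cube_Suc sum.distrib f1_def f2_def
          add_divide_distrib)
    finally show ?thesis by (simp only: cube_norm_def)
  qed
  finally show ?case .
qed

theorem noise_hypercontractive:
  fixes f :: "(nat \<Rightarrow> real) \<Rightarrow> 'a::real_normed_vector"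
  assumes pq: "1 < q" "q < p" and r: "r\<^sup>2 * (p - 1) \<le> q - 1"
  shows "cube_norm n p (noise r n f) \<le> cube_norm n q f"
proof -
  have r1: "\<bar>r\<bar> < 1" using assms by (intro abs_noise_less_1)
  have "cube_norm n p (noise r n f) \<le> cube_norm n p (noise r n (\<lambda>\<delta>. norm (f \<delta>)))"
  proof (intro cube_norm_mono)
    fix \<epsilon> assume "\<epsilon> \<in> cube n"
    then have "norm (noise r n f \<epsilon>) \<le> noise r n (\<lambda>\<delta>. norm (f \<delta>)) \<epsilon>"
      using r1 by (intro norm_noise_le) auto
    then show "norm (noise r n f \<epsilon>) \<le> norm (noise r n (\<lambda>\<delta>. norm (f \<delta>)) \<epsilon>)" by simp
  qed (use pq in auto)
  also have "\<dots> \<le> cube_norm n q (\<lambda>\<delta>. norm (f \<delta>))"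
    using assms by (intro noise_hypercontractive_nonneg) auto
  also have "\<dots> = cube_norm n q f" by (intro cube_norm_cong) simp
  finally show ?thesis .
qed

text \<open>
  Expanding the product kernel over the set of coordinates from which the noisy factor is taken yields
  one Walsh function for each subset.
\<close>

lemma noise_walsh:
  "noise r n f \<epsilon> = (\<Sum>A\<in>Pow {1..n}. r ^ card A *\<^sub>R walsh A \<epsilon> *\<^sub>R walsh_coeff n f A)"
proof -
  have K: "(\<Prod>i\<in>{1..n}. (1 + r * \<epsilon> i * \<delta> i) / 2)
      = (\<Sum>A\<in>Pow {1..n}. 1 / 2 ^ n * (r ^ card A * (walsh A \<epsilon> * walsh A \<delta>)))" for \<delta>
  proof -
    have "(\<Prod>i\<in>{1..n}. (1 + r * \<epsilon> i * \<delta> i) / 2) = (\<Prod>i\<in>{1..n}. r * \<epsilon> i * \<delta> i + 1) / 2 ^ n"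
      by (simp add: prod_dividef add.commute)
    also have "\<dots> = (\<Sum>A\<in>Pow {1..n}. r ^ card A * (walsh A \<epsilon> * walsh A \<delta>)) / 2 ^ n"
      by (subst prod_add) (auto simp: walsh_def prod.distrib mult_ac)
    finally show ?thesis by (simp add: sum_distrib_left sum_divide_distrib)
  qed
  have "noise r n f \<epsilon> = (\<Sum>\<delta>\<in>cube n. \<Sum>A\<in>Pow {1..n}.
      (1 / 2 ^ n * (r ^ card A * (walsh A \<epsilon> * walsh A \<delta>))) *\<^sub>R f \<delta>)"
    unfolding noise_def K by (simp only: scaleR_sum_left)
  also have "\<dots> = (\<Sum>A\<in>Pow {1..n}. \<Sum>\<delta>\<in>cube n.
      (1 / 2 ^ n * (r ^ card A * (walsh A \<epsilon> * walsh A \<delta>))) *\<^sub>R f \<delta>)"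
    by (rule sum.swap)
  also have "\<dots> = (\<Sum>A\<in>Pow {1..n}. r ^ card A *\<^sub>R walsh A \<epsilon> *\<^sub>R walsh_coeff n f A)"
    by (simp add: walsh_coeff_def scaleR_sum_right mult_ac)
  finally show ?thesis .
qed

text \<open>
  At \<open>r = 1\<close> the kernel is the indicator of the diagonal. Together with \<open>noise_walsh\<close> this is the
  Fourier inversion formula on the cube.
\<close>

lemma noise_1:
  assumes "\<epsilon> \<in> cube n"
  shows "noise 1 n f \<epsilon> = f \<epsilon>"
proof -
  have "(\<Prod>i\<in>{1..n}. (1 + 1 * \<epsilon> i * \<delta> i) / 2) = (if \<delta> = \<epsilon> then 1 else 0)" if "\<delta> \<in> cube n" for \<delta>
  proof (cases "\<delta> = \<epsilon>")
    case True
    have "(1 + 1 * \<epsilon> i * \<delta> i) / 2 = 1" if "i \<in> {1..n}" for i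
      using cube_value[OF assms that] True by auto
    then show ?thesis using True by simp
  next
    case False
    then obtain i where i: "i \<in> {1..n}" "\<delta> i \<noteq> \<epsilon> i"
      using PiE_ext[of \<delta> "{1..n}" "\<lambda>_. {-1, 1}" \<epsilon>] \<open>\<delta> \<in> cube n\<close> assms
      unfolding cube_def by blast
    then have "(1 + 1 * \<epsilon> i * \<delta> i) / 2 = 0"
      using cube_value[OF assms i(1)] cube_value[OF that i(1)] by auto
    then show ?thesis using i(1) False by (auto intro!: prod_zero)
  qed
  then have "noise 1 n f \<epsilon> = (\<Sum>\<delta>\<in>cube n. (if \<delta> = \<epsilon> then 1 else 0) *\<^sub>R f \<delta>)"
    unfolding noise_def by (intro sum.cong) auto
  also have "\<dots> = (\<Sum>\<delta>\<in>cube n. if \<delta> = \<epsilon> then f \<delta> else 0)"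
    by (intro sum.cong) auto
  finally show ?thesis using assms by simp
qed

section \<open>Extrapolation from Chebyshev nodes\<close>

lemma Lagrange_interpolation:
  fixes P :: "'a::field poly" and t :: "'i \<Rightarrow> 'a"
  assumes "finite I" "inj_on t I" "degree P < card I"
  shows "poly P x = (\<Sum>j\<in>I. (\<Prod>i\<in>I - {j}. (x - t i) / (t j - t i)) * poly P (t j))"
proof -
  define B where "B j = (\<Prod>i\<in>I - {j}. smult (1 / (t j - t i)) [:- t i, 1:])" for j
  have B: "poly (B j) y = (\<Prod>i\<in>I - {j}. (y - t i) / (t j - t i))" for j y
    by (simp add: B_def poly_prod diff_divide_distrib)
  have degB: "degree (B j) < card I" if "j \<in> I" for j
  proof -
    have "degree (B j) \<le> sum (degree \<circ> (\<lambda>i. smult (1 / (t j - t i)) [:- t i, 1:])) (I - {j})"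
      unfolding B_def by (rule degree_prod_sum_le) (use assms(1) in simp)
    also have "\<dots> \<le> (\<Sum>i\<in>I - {j}. 1)"
      by (intro sum_mono) auto
    also have "\<dots> < card I" using that assms(1) by (simp add: card_Diff1_less del: card_Diff_insert)
    finally show ?thesis .
  qed
  have "P = (\<Sum>j\<in>I. smult (poly P (t j)) (B j))"
  proof (rule poly_eqI_degree)
    fix y assume "y \<in> t ` I"
    then obtain k where k: "k \<in> I" "y = t k" by auto
    have "poly (B j) y = (if j = k then 1 else 0)" if "j \<in> I" for j
    proof (cases "j = k")
      case True
      have "(t k - t i) / (t k - t i) = 1" if "i \<in> I - {k}" for i
        using that k assms(2) by (auto dest: inj_onD)
      then show ?thesis using True k by (simp add: B)
    next
      case False
      then have "\<exists>i\<in>I - {j}. (y - t i) / (t j - t i) = 0" using k by auto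
      then show ?thesis using False assms(1) by (simp add: B prod_zero)
    qed
    then have "(\<Sum>j\<in>I. poly P (t j) * poly (B j) y) = (\<Sum>j\<in>I. if j = k then poly P (t j) else 0)"
      by (intro sum.cong) auto
    then show "poly P y = poly (\<Sum>j\<in>I. smult (poly P (t j)) (B j)) y"
      using k assms(1) by (simp add: poly_sum)
  next
    show "degree P < card (t ` I)" using assms by (simp add: card_image)
    show "degree (\<Sum>j\<in>I. smult (poly P (t j)) (B j)) < card (t ` I)"
      using assms degB
      by (auto simp: card_image intro!: degree_sum_less le_less_trans[OF degree_smult_le])
  qed
  then have "poly P x = poly (\<Sum>j\<in>I. smult (poly P (t j)) (B j)) x" by simp
  then show ?thesis by (simp add: poly_sum B mult.commute)
qed

text \<open>
  The nodes \<open>cos (j \<pi> / d)\<close> are the extremal points of \<open>T\<^sub>d\<close>, with \<open>T\<^sub>d(t\<^sub>j) = (-1)\<^bsup>j\<^esup>\<close>. They decrease in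
  \<open>j\<close> and lie to the left of \<open>x\<close>, so the Lagrange weight \<open>c\<^sub>j\<close> at \<open>x\<close> has exactly \<open>j\<close> negative
  factors and \<open>|c\<^sub>j| = c\<^sub>j T\<^sub>d(t\<^sub>j)\<close>. Interpolating \<open>T\<^sub>d\<close> itself evaluates the sum of the \<open>|c\<^sub>j|\<close>.
\<close>

lemma chebyshev_extrapolation:
  fixes x :: real
  assumes d: "d \<ge> 1" and x: "x > 1"
  obtains c t :: "nat \<Rightarrow> real"
  where "\<And>j. \<bar>t j\<bar> \<le> 1"
    and "\<And>k. k \<le> d \<Longrightarrow> (\<Sum>j\<le>d. c j * t j ^ k) = x ^ k"
    and "(\<Sum>j\<le>d. \<bar>c j\<bar>) = poly (chebyshev_T d) x"
proof -
  define t where "t j = cos (real j * pi / real d)" for j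
  define c where "c j = (\<Prod>i\<in>{..d} - {j}. (x - t i) / (t j - t i))" for j
  have dec: "t j < t i" if "i < j" "j \<le> d" for i j
    unfolding t_def using that d by (intro cos_monotone_0_pi) (auto simp: field_simps)
  have "inj_on t {..d}"
    by (rule linorder_inj_onI') (use dec in fastforce)
  then have interp: "poly P x = (\<Sum>j\<le>d. c j * poly P (t j))" if "degree P \<le> d" for P
    unfolding c_def using that by (intro Lagrange_interpolation) auto
  have less: "t i < x" for i using x by (simp add: t_def le_less_trans[OF cos_le_one])
  have sign: "\<bar>c j\<bar> = c j * (-1) ^ j" if "j \<le> d" for j
  proof -
    have "{..d} - {j} = {..<j} \<union> {j<..d}" using that by auto
    then have "c j = (\<Prod>i<j. (x - t i) / (t j - t i)) * (\<Prod>i\<in>{j<..d}. (x - t i) / (t j - t i))"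
      unfolding c_def \<open>{..d} - {j} = _\<close> by (intro prod.union_disjoint) auto
    then have "c j * (-1) ^ j = ((-1) ^ card {..<j} * (\<Prod>i<j. (x - t i) / (t j - t i)))
        * (\<Prod>i\<in>{j<..d}. (x - t i) / (t j - t i))"
      by simp
    also have "(-1) ^ card {..<j} * (\<Prod>i<j. (x - t i) / (t j - t i))
        = (\<Prod>i<j. - ((x - t i) / (t j - t i)))"
      by (rule prod_uminus[symmetric])
    also have "\<dots> * (\<Prod>i\<in>{j<..d}. (x - t i) / (t j - t i)) \<ge> 0"
    proof (intro mult_nonneg_nonneg prod_nonneg)
      fix i assume "i \<in> {..<j}"
      then show "0 \<le> - ((x - t i) / (t j - t i))"
        using less[of i] dec[of i j] that by (simp add: divide_nonneg_neg divide_nonneg_nonpos)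
    next
      fix i assume "i \<in> {j<..d}"
      then show "0 \<le> (x - t i) / (t j - t i)"
        using less[of i] dec[of j i] by simp
    qed
    finally have "c j * (-1) ^ j = \<bar>c j * (-1) ^ j\<bar>" by simp
    then show ?thesis by (simp add: abs_mult power_abs)
  qed
  show ?thesis
  proof
    show "\<bar>t j\<bar> \<le> 1" for j by (simp add: t_def)
    show "(\<Sum>j\<le>d. c j * t j ^ k) = x ^ k" if "k \<le> d" for k
      using interp[of "monom 1 k"] that by (simp add: poly_monom degree_monom_eq)
    have "poly (chebyshev_T d) (t j) = (-1) ^ j" for j
      using d by (simp add: t_def chebyshev_T(2) cos_npi)
    then show "(\<Sum>j\<le>d. \<bar>c j\<bar>) = poly (chebyshev_T d) x"
      using interp[of "chebyshev_T d"] sign by (simp add: chebyshev_T(1))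
  qed
qed

section \<open>Comparison of moments for functions of bounded degree\<close>

theorem corollary2:
  fixes n d :: nat and p q :: real
    and f :: "(nat \<Rightarrow> real) \<Rightarrow> 'a::complex_banach"
  assumes "d \<in> {1..n}"
    and "1 < q" and "q < p"
    and "degree_at_most n d f"
  shows "cube_norm n p f \<le> poly (chebyshev_T d) (sqrt ((p - 1) / (q - 1))) * cube_norm n q f"
proof -
  define x where "x = sqrt ((p - 1) / (q - 1))"
  have x: "x > 1" using assms by (simp add: x_def)
  have x2: "x\<^sup>2 = (p - 1) / (q - 1)" using assms by (simp add: x_def)
  have "d \<ge> 1" using assms by simp
  then obtain c t :: "nat \<Rightarrow> real" where t: "\<And>j. \<bar>t j\<bar> \<le> 1"
    and power: "\<And>k. k \<le> d \<Longrightarrow> (\<Sum>j\<le>d. c j * t j ^ k) = x ^ k"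
    and weight: "(\<Sum>j\<le>d. \<bar>c j\<bar>) = poly (chebyshev_T d) x"
    by (rule chebyshev_extrapolation[OF _ x]) (rule that; assumption)
  have power': "(\<Sum>j\<le>d. c j * (t j / x) ^ k) = 1" if "k \<le> d" for k
  proof -
    have "(\<Sum>j\<le>d. c j * (t j / x) ^ k) = (\<Sum>j\<le>d. c j * t j ^ k) / x ^ k"
      by (simp add: power_divide sum_divide_distrib)
    then show ?thesis using power[OF that] x by simp
  qed
  \<comment> \<open>Frequencies above \<open>d\<close>, which are out of reach of the extrapolation formula, have zero coefficients.\<close>
  have expand: "f \<epsilon> = (\<Sum>j\<le>d. c j *\<^sub>R noise (t j / x) n f \<epsilon>)" if \<epsilon>: "\<epsilon> \<in> cube n" for \<epsilon>
  proof -
    have "f \<epsilon> = (\<Sum>A\<in>Pow {1..n}. walsh A \<epsilon> *\<^sub>R walsh_coeff n f A)"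
      using noise_walsh[of 1 n f \<epsilon>] noise_1[OF \<epsilon>, of f] by simp
    also have "\<dots> = (\<Sum>A\<in>Pow {1..n}. \<Sum>j\<le>d. (c j * (t j / x) ^ card A) *\<^sub>R walsh A \<epsilon> *\<^sub>R walsh_coeff n f A)"
    proof (intro sum.cong refl)
      fix A assume A: "A \<in> Pow {1..n}"
      show "walsh A \<epsilon> *\<^sub>R walsh_coeff n f A
          = (\<Sum>j\<le>d. (c j * (t j / x) ^ card A) *\<^sub>R walsh A \<epsilon> *\<^sub>R walsh_coeff n f A)"
      proof (cases "card A \<le> d")
        case True
        then show ?thesis by (simp only: scaleR_sum_left[symmetric] power') simp
      next
        case False
        then have "walsh_coeff n f A = 0"
          using assms(4) A by (simp add: degree_at_most_def)
        then show ?thesis by simp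
      qed
    qed
    also have "\<dots> = (\<Sum>j\<le>d. \<Sum>A\<in>Pow {1..n}. (c j * (t j / x) ^ card A) *\<^sub>R walsh A \<epsilon> *\<^sub>R walsh_coeff n f A)"
      by (rule sum.swap)
    also have "\<dots> = (\<Sum>j\<le>d. c j *\<^sub>R noise (t j / x) n f \<epsilon>)"
      unfolding noise_walsh by (simp add: scaleR_sum_right mult.assoc)
    finally show ?thesis .
  qed
  have small: "(t j / x)\<^sup>2 * (p - 1) \<le> q - 1" for j
  proof -
    have "(t j / x)\<^sup>2 * (p - 1) = (t j)\<^sup>2 * (q - 1)"
      using assms by (simp add: power_divide x2)
    also have "\<dots> \<le> 1 * (q - 1)"
      using assms t[of j] by (intro mult_right_mono) (auto simp: abs_square_le_1)
    finally show ?thesis by simp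
  qed
  have "cube_norm n p f = cube_norm n p (\<lambda>\<epsilon>. \<Sum>j\<le>d. c j *\<^sub>R noise (t j / x) n f \<epsilon>)"
    using expand by (intro cube_norm_cong) simp
  also have "\<dots> \<le> (\<Sum>j\<le>d. cube_norm n p (\<lambda>\<epsilon>. c j *\<^sub>R noise (t j / x) n f \<epsilon>))"
    using assms by (intro cube_norm_sum) auto
  also have "\<dots> = (\<Sum>j\<le>d. \<bar>c j\<bar> * cube_norm n p (noise (t j / x) n f))"
    using assms by (subst cube_norm_scaleR) auto
  also have "\<dots> \<le> (\<Sum>j\<le>d. \<bar>c j\<bar> * cube_norm n q f)"
    using assms small by (intro sum_mono mult_left_mono noise_hypercontractive) auto
  also have "\<dots> = poly (chebyshev_T d) x * cube_norm n q f"
    by (simp add: weight flip: sum_distrib_right)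
  finally show ?thesis by (simp add: x_def)
qed

end
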